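(* Let $T_1,T_2:V\to\mathfrak g$ be two $\mathcal O$-operators on a pre-Lie algebra $(\mathfrak g,\cdot_{\mathfrak g})$ associated to a representation $(V;\rho,\mu)$. Suppose that $T_2$ is invertible. If $T_1$ and $T_2$ are compatible, then $N=T_1\circ T_2^{-1}$ is a Nijenhuis operator on the pre-Lie algebra $(\mathfrak g,\cdot_{\mathfrak g})$.
   Context: $\mathbb K$ is an algebraically closed field of characteristic $0$; vector spaces are finite dimensional over $\mathbb K$. A pre-Lie algebra is a vector space $\mathfrak g$ with a bilinear product $\cdot_{\mathfrak g}$ such that $(x\cdot_{\mathfrak g} y)\cdot_{\mathfrak g} z-x\cdot_{\mathfrak g}(y\cdot_{\mathfrak g} z)$ is symmetric in $x,y$; $[x,y]^c=x\cdot_{\mathfrak g}y-y\cdot_{\mathfrak g}x$ is then a Lie bracket. A representation $(V;\rho,\mu)$ consists of a vector space $V$, a representation $\rho:\mathfrak g\to\mathfrak{gl}(V)$ of the Lie algebra $(\mathfrak g,[\cdot,\cdot]^c)$ and a linear map $\mu:\mathfrak g\to\mathfrak{gl}(V)$ with $\rho(x)\mu(y)-\mu(y)\rho(x)=\mu(x\cdot_{\mathfrak g}y)-\mu(y)\mu(x)$ for all $x,y\in\mathfrak g$. A linear map $T:V\to\mathfrak g$ is an $\mathcal O$-operator associated to $(V;\rho,\mu)$ if $T(u)\cdot_{\mathfrak g}T(v)=T\big(\rho(T(u))(v)+\mu(T(v))(u)\big)$ for all $u,v\in V$. Two $\mathcal O$-operators $T_1,T_2$ associated to $(V;\rho,\mu)$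 are compatible if $k_1T_1+k_2T_2$ is an $\mathcal O$-operator associated to $(V;\rho,\mu)$ for all $k_1,k_2\in\mathbb K$. A linear map $N:\mathfrak g\to\mathfrak g$ is a Nijenhuis operator if $N(x)\cdot_{\mathfrak g}N(y)=N\big(N(x)\cdot_{\mathfrak g}y+x\cdot_{\mathfrak g}N(y)-N(x\cdot_{\mathfrak g}y)\big)$ for all $x,y$. *)

theory Defs
  imports "HOL-Computational_Algebra.Polynomial"
begin

definition bilinear_map ::
  "('k::field \<Rightarrow> 'a::ab_group_add \<Rightarrow> 'a) \<Rightarrow> ('k \<Rightarrow> 'b::ab_group_add \<Rightarrow> 'b) \<Rightarrow>
   ('k \<Rightarrow> 'c::ab_group_add \<Rightarrow> 'c) \<Rightarrow> ('a \<Rightarrow> 'b \<Rightarrow> 'c) \<Rightarrow> bool" where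
  "bilinear_map sa sb sc f \<longleftrightarrow>
     (\<forall>x. Vector_Spaces.linear sb sc (f x)) \<and>
     (\<forall>y. Vector_Spaces.linear sa sc (\<lambda>x. f x y))"

definition pre_lie_algebra ::
  "('k::field \<Rightarrow> 'g::ab_group_add \<Rightarrow> 'g) \<Rightarrow> ('g \<Rightarrow> 'g \<Rightarrow> 'g) \<Rightarrow> bool" where
  "pre_lie_algebra sg m \<longleftrightarrow>
     vector_space sg \<and> bilinear_map sg sg sg m \<and>
     (\<forall>x y z. m (m x y) z - m x (m y z) = m (m y x) z - m y (m x z))"

definition commutator_bracket :: "('g::ab_group_add \<Rightarrow> 'g \<Rightarrow> 'g) \<Rightarrow> 'g \<Rightarrow> 'g \<Rightarrow> 'g" where
  "commutator_bracket m x y = m x y - m y x"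

text \<open>A linear map from \<open>g\<close> to \<open>gl(V)\<close> is encoded by its uncurried action, a bilinear map
  from \<open>g\<close> and \<open>V\<close> to \<open>V\<close>.\<close>

definition lie_representation ::
  "('k::field \<Rightarrow> 'g::ab_group_add \<Rightarrow> 'g) \<Rightarrow> ('g \<Rightarrow> 'g \<Rightarrow> 'g) \<Rightarrow>
   ('k \<Rightarrow> 'v::ab_group_add \<Rightarrow> 'v) \<Rightarrow> ('g \<Rightarrow> 'v \<Rightarrow> 'v) \<Rightarrow> bool" where
  "lie_representation sg br sv \<rho> \<longleftrightarrow>
     bilinear_map sg sv sv \<rho> \<and>
     (\<forall>x y v. \<rho> (br x y) v = \<rho> x (\<rho> y v) - \<rho> y (\<rho> x v))"

definition pre_lie_representation ::
  "('k::field \<Rightarrow> 'g::ab_group_add \<Rightarrow> 'g) \<Rightarrow> ('g \<Rightarrow> 'g \<Rightarrow> 'g) \<Rightarrow>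
   ('k \<Rightarrow> 'v::ab_group_add \<Rightarrow> 'v) \<Rightarrow> ('g \<Rightarrow> 'v \<Rightarrow> 'v) \<Rightarrow> ('g \<Rightarrow> 'v \<Rightarrow> 'v) \<Rightarrow> bool" where
  "pre_lie_representation sg m sv \<rho> \<mu> \<longleftrightarrow>
     vector_space sv \<and>
     lie_representation sg (commutator_bracket m) sv \<rho> \<and>
     bilinear_map sg sv sv \<mu> \<and>
     (\<forall>x y v. \<rho> x (\<mu> y v) - \<mu> y (\<rho> x v) = \<mu> (m x y) v - \<mu> y (\<mu> x v))"

definition O_operator ::
  "('k::field \<Rightarrow> 'g::ab_group_add \<Rightarrow> 'g) \<Rightarrow> ('g \<Rightarrow> 'g \<Rightarrow> 'g) \<Rightarrow>
   ('k \<Rightarrow> 'v::ab_group_add \<Rightarrow> 'v) \<Rightarrow> ('g \<Rightarrow> 'v \<Rightarrow> 'v) \<Rightarrow> ('g \<Rightarrow> 'v \<Rightarrow> 'v) \<Rightarrow> ('v \<Rightarrow> 'g) \<Rightarrow> bool" where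
  "O_operator sg m sv \<rho> \<mu> T \<longleftrightarrow>
     Vector_Spaces.linear sv sg T \<and>
     (\<forall>u v. m (T u) (T v) = T (\<rho> (T u) v + \<mu> (T v) u))"

definition compatible_O_operators ::
  "('k::field \<Rightarrow> 'g::ab_group_add \<Rightarrow> 'g) \<Rightarrow> ('g \<Rightarrow> 'g \<Rightarrow> 'g) \<Rightarrow>
   ('k \<Rightarrow> 'v::ab_group_add \<Rightarrow> 'v) \<Rightarrow> ('g \<Rightarrow> 'v \<Rightarrow> 'v) \<Rightarrow> ('g \<Rightarrow> 'v \<Rightarrow> 'v) \<Rightarrow>
   ('v \<Rightarrow> 'g) \<Rightarrow> ('v \<Rightarrow> 'g) \<Rightarrow> bool" where
  "compatible_O_operators sg m sv \<rho> \<mu> T1 T2 \<longleftrightarrow>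
     (\<forall>k1 k2. O_operator sg m sv \<rho> \<mu> (\<lambda>v. sg k1 (T1 v) + sg k2 (T2 v)))"

definition nijenhuis_operator ::
  "('k::field \<Rightarrow> 'g::ab_group_add \<Rightarrow> 'g) \<Rightarrow> ('g \<Rightarrow> 'g \<Rightarrow> 'g) \<Rightarrow> ('g \<Rightarrow> 'g) \<Rightarrow> bool" where
  "nijenhuis_operator sg m N \<longleftrightarrow>
     Vector_Spaces.linear sg sg N \<and>
     (\<forall>x y. m (N x) (N y) = N (m (N x) y + m x (N y) - N (m x y)))"

end

theory Submission
  imports Defs
begin

text \<open>
  Write \<open>D1 u v = \<rho> (T1 u) v + \<mu> (T1 v) u\<close>, and \<open>D2\<close> likewise for \<open>T2\<close>, so that a linear \<open>T1\<close>
  is an \<open>O\<close>-operator iff \<open>m (T1 u) (T1 v) = T1 (D1 u v)\<close>. Both sides of this identity are quadratic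
  in the operator, so imposing it on \<open>T1\<close>, \<open>T2\<close> and \<open>T1 + T2\<close> leaves exactly the mixed identity
  \<open>m (T1 u) (T2 v) + m (T2 u) (T1 v) = T1 (D2 u v) + T2 (D1 u v)\<close>,
  which is \<open>O_operator_sum_mixed_identity\<close>.

  Now put \<open>x = T2 u\<close> and \<open>y = T2 v\<close>, which reaches every pair of elements because \<open>T2\<close> is
  surjective, and let \<open>N = T1 \<circ> inv T2\<close>. Then \<open>N x = T1 u\<close> and \<open>N y = T1 v\<close>, while the equation
  for \<open>T2\<close> gives \<open>N (m x y) = T1 (D2 u v)\<close>. The mixed identity therefore says
  \<open>m (N x) y + m x (N y) - N (m x y) = T2 (D1 u v)\<close>. Applying \<open>N\<close> turns the right-hand side into
  \<open>T1 (D1 u v)\<close>, which equals \<open>m (N x) (N y)\<close> by the equation for \<open>T1\<close>.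
\<close>

lemma bilinear_map_add_left:
  "bilinear_map sa sb sc f \<Longrightarrow> f (x + x') y = f x y + f x' y"
  by (auto simp: bilinear_map_def Vector_Spaces.linear_iff)

lemma bilinear_map_add_right:
  "bilinear_map sa sb sc f \<Longrightarrow> f x (y + y') = f x y + f x y'"
  by (auto simp: bilinear_map_def Vector_Spaces.linear_iff)

lemma linear_inv_bij:
  assumes "Vector_Spaces.linear s1 s2 T" and "bij T"
  shows "Vector_Spaces.linear s2 s1 (inv T)"
proof -
  have surj: "T (inv T x) = x" for x
    using assms(2) by (simp add: bij_is_surj surj_f_inv_f)
  have inv_eqI: "inv T x = v" if "T v = x" for x v
    using that assms(2) by (auto simp: bij_is_inj inv_f_eq)
  show ?thesis
    using assms(1) unfolding Vector_Spaces.linear_iff by (auto intro!: inv_eqI simp: surj)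
qed

text \<open>The polarisation of the quadratic \<open>\<O>\<close>-operator equation: expanding it for \<open>T1 + T2\<close>, the
  pure terms cancel against the equations for \<open>T1\<close> and \<open>T2\<close>.\<close>

lemma O_operator_sum_mixed_identity:
  assumes m: "bilinear_map sg sg sg m"
    and \<rho>: "bilinear_map sg sv sv \<rho>"
    and \<mu>: "bilinear_map sg sv sv \<mu>"
    and T1: "O_operator sg m sv \<rho> \<mu> T1"
    and T2: "O_operator sg m sv \<rho> \<mu> T2"
    and sum: "O_operator sg m sv \<rho> \<mu> (\<lambda>v. T1 v + T2 v)"
  shows "m (T1 u) (T2 v) + m (T2 u) (T1 v) =
    T1 (\<rho> (T2 u) v + \<mu> (T2 v) u) + T2 (\<rho> (T1 u) v + \<mu> (T1 v) u)"
proof -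
  let ?D1 = "\<rho> (T1 u) v + \<mu> (T1 v) u" and ?D2 = "\<rho> (T2 u) v + \<mu> (T2 v) u"
  have add: "T1 (a + b) = T1 a + T1 b" "T2 (a + b) = T2 a + T2 b" for a b
    using T1 T2 by (auto simp: O_operator_def Vector_Spaces.linear_iff)
  have D: "\<rho> (T1 u + T2 u) v + \<mu> (T1 v + T2 v) u = ?D1 + ?D2"
    by (simp add: bilinear_map_add_left[OF \<rho>] bilinear_map_add_left[OF \<mu>] algebra_simps)
  have "m (T1 u) (T1 v) + m (T1 u) (T2 v) + (m (T2 u) (T1 v) + m (T2 u) (T2 v)) =
      m (T1 u + T2 u) (T1 v + T2 v)"
    by (simp add: bilinear_map_add_left[OF m] bilinear_map_add_right[OF m])
  also have "\<dots> = T1 (?D1 + ?D2) + T2 (?D1 + ?D2)"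
    using sum unfolding O_operator_def by (simp add: D)
  also have "\<dots> = (T1 ?D1 + T1 ?D2) + (T2 ?D1 + T2 ?D2)"
    by (simp only: add(1)[of ?D1 ?D2] add(2)[of ?D1 ?D2])
  also have "T1 ?D1 = m (T1 u) (T1 v)"
    using T1 by (simp add: O_operator_def)
  also have "T2 ?D2 = m (T2 u) (T2 v)"
    using T2 by (simp add: O_operator_def)
  finally show ?thesis
    by (simp add: algebra_simps)
qed

theorem proposition5p11:
  fixes sg :: "'k::{alg_closed_field, field_char_0} \<Rightarrow> 'g::ab_group_add \<Rightarrow> 'g"
    and sv :: "'k \<Rightarrow> 'v::ab_group_add \<Rightarrow> 'v"
    and Bg :: "'g set" and Bv :: "'v set"
    and m :: "'g \<Rightarrow> 'g \<Rightarrow> 'g"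
    and \<rho> \<mu> :: "'g \<Rightarrow> 'v \<Rightarrow> 'v"
    and T1 T2 :: "'v \<Rightarrow> 'g"
  assumes "finite_dimensional_vector_space sg Bg"
    and "finite_dimensional_vector_space sv Bv"
    and "pre_lie_algebra sg m"
    and "pre_lie_representation sg m sv \<rho> \<mu>"
    and "O_operator sg m sv \<rho> \<mu> T1"
    and "O_operator sg m sv \<rho> \<mu> T2"
    and "bij T2"
    and "compatible_O_operators sg m sv \<rho> \<mu> T1 T2"
  shows "nijenhuis_operator sg m (T1 \<circ> inv T2)"
proof -
  let ?N = "T1 \<circ> inv T2"
  note O1 = assms(5) and O2 = assms(6)
  have lin1: "Vector_Spaces.linear sv sg T1" and lin2: "Vector_Spaces.linear sv sg T2"
    using O1 O2 by (auto simp: O_operator_def)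
  have m: "bilinear_map sg sg sg m"
    using assms(3) by (simp add: pre_lie_algebra_def)
  have \<rho>: "bilinear_map sg sv sv \<rho>" and \<mu>: "bilinear_map sg sv sv \<mu>"
    using assms(4) by (auto simp: pre_lie_representation_def lie_representation_def)
  have sum: "O_operator sg m sv \<rho> \<mu> (\<lambda>v. T1 v + T2 v)"
  proof -
    have "sg 1 x = x" for x
      using assms(3) by (simp add: pre_lie_algebra_def vector_space_def)
    moreover have "O_operator sg m sv \<rho> \<mu> (\<lambda>v. sg 1 (T1 v) + sg 1 (T2 v))"
      using assms(8) unfolding compatible_O_operators_def by blast
    ultimately show ?thesis by simp
  qed
  have N_T2: "?N (T2 v) = T1 v" for v
    using assms(7) by (simp add: bij_is_inj)
  have "m (?N x) (?N y) = ?N (m (?N x) y + m x (?N y) - ?N (m x y))" for x y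
  proof -
    obtain u v where x: "x = T2 u" and y: "y = T2 v"
      using assms(7) by (meson bij_pointE)
    let ?D1 = "\<rho> (T1 u) v + \<mu> (T1 v) u" and ?D2 = "\<rho> (T2 u) v + \<mu> (T2 v) u"
    have Nx: "?N x = T1 u" and Ny: "?N y = T1 v"
      unfolding x y by (rule N_T2)+
    have "m x y = T2 ?D2"
      using O2 by (simp add: O_operator_def x y)
    then have Nxy: "?N (m x y) = T1 ?D2"
      by (simp only: N_T2)
    have "m (?N x) y + m x (?N y) - ?N (m x y) = T2 ?D1"
      unfolding Nx Ny Nxy unfolding x y
      using O_operator_sum_mixed_identity[OF m \<rho> \<mu> O1 O2 sum, of u v] by simp
    then have "?N (m (?N x) y + m x (?N y) - ?N (m x y)) = T1 ?D1"
      by (simp only: N_T2)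
    also have "\<dots> = m (?N x) (?N y)"
      using O1 unfolding Nx Ny O_operator_def by simp
    finally show ?thesis by (rule sym)
  qed
  moreover have "Vector_Spaces.linear sg sg ?N"
    using linear_inv_bij[OF lin2 assms(7)] lin1 by (rule Vector_Spaces.linear_compose)
  ultimately show ?thesis
    unfolding nijenhuis_operator_def by blast
qed

end
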